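(* Let $M=\{0,1\}$ be the multiplicative monoid and $\alpha$ a strong partial action of $M$ on a semigroup $X$ such that $\operatorname{dom}\alpha_m$ and $\operatorname{im}\alpha_m$ are ideals of $X$ for all $m\in M$. If $\operatorname{dom}\alpha_0$ and $\operatorname{im}\alpha_0$ are unital ideals of $X$, then $\alpha$ is globalizable (in the category of semigroups).
   Context: Let $M$ be a monoid with identity $e$. A strong partial action of $M$ on a set $X$ is a family $\alpha=\{\alpha_m:\operatorname{dom}\alpha_m\to X\}_{m\in M}$ of maps with $\operatorname{dom}\alpha_m\subseteq X$ such that: (1) $\operatorname{dom}\alpha_e=X$ and $\alpha_e=\mathrm{id}_X$; (2) $\alpha_m^{-1}(\operatorname{dom}\alpha_n)=\operatorname{dom}\alpha_{nm}\cap\operatorname{dom}\alpha_m$ for all $m,n\in M$; (3) $\alpha_n\circ\alpha_m=\alpha_{nm}$ on $\alpha_m^{-1}(\operatorname{dom}\alpha_n)$ for all $m,n\in M$. It is a global action if $\operatorname{dom}\alpha_m=X$ for all $m$. A strong partial action (global action) of $M$ on a semigroup $X$ is one on the underlying set such that each $\operatorname{dom}\alpha_m$ is a subsemigroup of $X$ and each $\alpha_m$ is a semigroup homomorphism. Write $\operatorname{im}\alpha_m=\alpha_m(\operatorname{dom}\alpha_m)$. Ideals are two-sided; an ideal is unital if it has an identity element as a semigroup in its own right ($X$ itself is not assumed unital). If $\alpha$ is a strong partial action of $M$ on a semigroup $X$ and $\beta$ is a global action of $M$ on a semigroup $Y$, a morphism $\iota:\alpha\to\beta$ is a semigroup homomorphism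 $\iota:X\to Y$ with $\beta_m(\iota(x))=\iota(\alpha_m(x))$ for all $m\in M$, $x\in\operatorname{dom}\alpha_m$. A globalization of $\alpha$ is a pair $(\beta,\iota)$, with $\beta$ a global action of $M$ on a semigroup and $\iota:\alpha\to\beta$ a morphism, such that for all $x,y\in X$ and $m\in M$ with $\beta_m(\iota(x))=\iota(y)$ one has $x\in\operatorname{dom}\alpha_m$ and $\alpha_m(x)=y$. $\alpha$ is globalizable if it has a globalization. *)

theory Defs
  imports "HOL-Algebra.Group"
begin

(* HOL-Algebra has no structure below monoids, and the record of a monoid carries a unit;
   hence a separate record for semigroups. The empty semigroup is allowed. *)
record 'a semigrp = "'a partial_object" +
  sg_mult :: "'a \<Rightarrow> 'a \<Rightarrow> 'a" (infixl "\<cdot>\<index>" 70)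

locale semigrp =
  fixes X (structure)
  assumes mult_closed: "\<lbrakk>x \<in> carrier X; y \<in> carrier X\<rbrakk> \<Longrightarrow> x \<cdot> y \<in> carrier X"
    and mult_assoc: "\<lbrakk>x \<in> carrier X; y \<in> carrier X; z \<in> carrier X\<rbrakk>
      \<Longrightarrow> (x \<cdot> y) \<cdot> z = x \<cdot> (y \<cdot> z)"

definition subsemigrp :: "'a set \<Rightarrow> ('a, 'c) semigrp_scheme \<Rightarrow> bool" where
  "subsemigrp S X \<longleftrightarrow> S \<subseteq> carrier X \<and> (\<forall>x\<in>S. \<forall>y\<in>S. x \<cdot>\<^bsub>X\<^esub> y \<in> S)"

definition semigrp_ideal :: "'a set \<Rightarrow> ('a, 'c) semigrp_scheme \<Rightarrow> bool" where
  "semigrp_ideal I X \<longleftrightarrow> I \<subseteq> carrier X \<and>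
     (\<forall>i\<in>I. \<forall>x\<in>carrier X. x \<cdot>\<^bsub>X\<^esub> i \<in> I \<and> i \<cdot>\<^bsub>X\<^esub> x \<in> I)"

definition unital_ideal :: "'a set \<Rightarrow> ('a, 'c) semigrp_scheme \<Rightarrow> bool" where
  "unital_ideal I X \<longleftrightarrow> semigrp_ideal I X \<and>
     (\<exists>u\<in>I. \<forall>i\<in>I. u \<cdot>\<^bsub>X\<^esub> i = i \<and> i \<cdot>\<^bsub>X\<^esub> u = i)"

definition semigrp_hom ::
    "('a, 'c) semigrp_scheme \<Rightarrow> ('b, 'd) semigrp_scheme \<Rightarrow> ('a \<Rightarrow> 'b) set" where
  "semigrp_hom X Y = {f \<in> carrier X \<rightarrow> carrier Y.
     \<forall>x\<in>carrier X. \<forall>y\<in>carrier X. f (x \<cdot>\<^bsub>X\<^esub> y) = f x \<cdot>\<^bsub>Y\<^esub> f y}"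

(* The partially defined maps are maps in the sense of HOL.Map, so that the domain and the
   image of the m-th one are dom (\<alpha> m) and ran (\<alpha> m). *)
locale strong_partial_action = monoid M for M (structure) +
  fixes X :: "'b set" and \<alpha> :: "'a \<Rightarrow> 'b \<rightharpoonup> 'b"
  assumes dom_subset: "m \<in> carrier M \<Longrightarrow> dom (\<alpha> m) \<subseteq> X"
    and ran_subset: "m \<in> carrier M \<Longrightarrow> ran (\<alpha> m) \<subseteq> X"
    and dom_one: "dom (\<alpha> \<one>) = X"
    and act_one: "x \<in> X \<Longrightarrow> \<alpha> \<one> x = Some x"
    and preimage_dom: "\<lbrakk>m \<in> carrier M; n \<in> carrier M\<rbrakk>
      \<Longrightarrow> {x \<in> dom (\<alpha> m). the (\<alpha> m x) \<in> dom (\<alpha> n)} = dom (\<alpha> (n \<otimes> m)) \<inter> dom (\<alpha> m)"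
    and act_mult: "\<lbrakk>m \<in> carrier M; n \<in> carrier M; x \<in> dom (\<alpha> m); the (\<alpha> m x) \<in> dom (\<alpha> n)\<rbrakk>
      \<Longrightarrow> \<alpha> n (the (\<alpha> m x)) = \<alpha> (n \<otimes> m) x"

locale semigrp_strong_partial_action =
  semigrp X + strong_partial_action M "carrier X" \<alpha> for M and X and \<alpha> +
  assumes subsemigrp_dom: "m \<in> carrier M \<Longrightarrow> subsemigrp (dom (\<alpha> m)) X"
    and act_hom: "m \<in> carrier M
      \<Longrightarrow> (\<lambda>x. the (\<alpha> m x)) \<in> semigrp_hom (X\<lparr>carrier := dom (\<alpha> m)\<rparr>) X"

locale semigrp_global_action = semigrp_strong_partial_action +
  assumes global: "m \<in> carrier M \<Longrightarrow> dom (\<alpha> m) = carrier X"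

definition action_morphism ::
    "('m, 'e) monoid_scheme \<Rightarrow> ('a, 'c) semigrp_scheme \<Rightarrow> ('m \<Rightarrow> 'a \<rightharpoonup> 'a)
      \<Rightarrow> ('b, 'd) semigrp_scheme \<Rightarrow> ('m \<Rightarrow> 'b \<rightharpoonup> 'b) \<Rightarrow> ('a \<Rightarrow> 'b) \<Rightarrow> bool" where
  "action_morphism M X \<alpha> Y \<beta> \<iota> \<longleftrightarrow> \<iota> \<in> semigrp_hom X Y \<and>
     (\<forall>m\<in>carrier M. \<forall>x\<in>dom (\<alpha> m). \<beta> m (\<iota> x) = Some (\<iota> (the (\<alpha> m x))))"

definition globalization ::
    "('m, 'e) monoid_scheme \<Rightarrow> ('a, 'c) semigrp_scheme \<Rightarrow> ('m \<Rightarrow> 'a \<rightharpoonup> 'a)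
      \<Rightarrow> ('b, 'd) semigrp_scheme \<Rightarrow> ('m \<Rightarrow> 'b \<rightharpoonup> 'b) \<Rightarrow> ('a \<Rightarrow> 'b) \<Rightarrow> bool" where
  "globalization M X \<alpha> Y \<beta> \<iota> \<longleftrightarrow>
     semigrp_global_action M Y \<beta> \<and> action_morphism M X \<alpha> Y \<beta> \<iota> \<and>
     (\<forall>x\<in>carrier X. \<forall>y\<in>carrier X. \<forall>m\<in>carrier M.
        \<beta> m (\<iota> x) = Some (\<iota> y) \<longrightarrow> x \<in> dom (\<alpha> m) \<and> \<alpha> m x = Some y)"

(* An existential quantifier cannot range over semigroups of all types. The type chosen here
   is that of the elements of a quotient of the free semigroup on M \<times> X; lemma globalizableI below
   shows that this is no restriction. *)
definition globalizable ::
    "('m, 'e) monoid_scheme \<Rightarrow> ('a, 'c) semigrp_scheme \<Rightarrow> ('m \<Rightarrow> 'a \<rightharpoonup> 'a) \<Rightarrow> bool" where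
  "globalizable M X \<alpha> \<longleftrightarrow>
     (\<exists>(Y :: ('m \<times> 'a) list set semigrp) \<beta> \<iota>. globalization M X \<alpha> Y \<beta> \<iota>)"

definition monoid01 :: "nat monoid" where
  "monoid01 = \<lparr>carrier = {0, 1}, monoid.mult = (*), one = 1\<rparr>"

lemma monoid_monoid01: "monoid monoid01"
  by unfold_locales (auto simp: monoid01_def)

fun word_eval :: "('y \<Rightarrow> 'y \<Rightarrow> 'y) \<Rightarrow> ('p \<Rightarrow> 'y) \<Rightarrow> 'p list \<Rightarrow> 'y" where
  "word_eval f g [] = undefined"
| "word_eval f g [p] = g p"
| "word_eval f g (p # q # w) = f (g p) (word_eval f g (q # w))"

lemma globalizableI:
  fixes M :: "('m, 'e) monoid_scheme" and X :: "('a, 'c) semigrp_scheme"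
    and Y :: "('y, 'd) semigrp_scheme"
  assumes "semigrp_strong_partial_action M X \<alpha>"
    and glob: "globalization M X \<alpha> Y \<beta> \<iota>"
  shows "globalizable M X \<alpha>"
proof -
  interpret A: semigrp_strong_partial_action M X \<alpha> by fact
  interpret B: semigrp_global_action M Y \<beta>
    using glob by (simp add: globalization_def)
  have iota: "\<iota> x \<in> carrier Y" if "x \<in> carrier X" for x
    using glob that by (auto simp: globalization_def action_morphism_def semigrp_hom_def)
  have iota_mult: "\<iota> (x \<cdot>\<^bsub>X\<^esub> y) = \<iota> x \<cdot>\<^bsub>Y\<^esub> \<iota> y" if "x \<in> carrier X" "y \<in> carrier X" for x y
    using glob that by (auto simp: globalization_def action_morphism_def semigrp_hom_def)
  have iota_act: "\<beta> m (\<iota> x) = Some (\<iota> (the (\<alpha> m x)))" if "m \<in> carrier M" "x \<in> dom (\<alpha> m)" for m x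
    using glob that by (auto simp: globalization_def action_morphism_def)
  have refl: "x \<in> dom (\<alpha> m) \<and> \<alpha> m x = Some y"
    if "x \<in> carrier X" "y \<in> carrier X" "m \<in> carrier M" "\<beta> m (\<iota> x) = Some (\<iota> y)" for x y m
    using glob that unfolding globalization_def by blast
  define b where "b m y = the (\<beta> m y)" for m y
  have beta: "\<beta> m y = Some (b m y)" if "m \<in> carrier M" "y \<in> carrier Y" for m y
  proof -
    have "y \<in> dom (\<beta> m)" using B.global that by auto
    then show ?thesis by (auto simp: b_def)
  qed
  have b_closed: "b m y \<in> carrier Y" if "m \<in> carrier M" "y \<in> carrier Y" for m y
    using B.ran_subset[OF that(1)] beta[OF that] by (auto simp: ran_def)
  have b_mult: "b m (y \<cdot>\<^bsub>Y\<^esub> z) = b m y \<cdot>\<^bsub>Y\<^esub> b m z"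
    if "m \<in> carrier M" "y \<in> carrier Y" "z \<in> carrier Y" for m y z
    using B.act_hom[OF that(1)] B.global[OF that(1)] that
    by (auto simp: semigrp_hom_def b_def)
  have b_one: "b \<one>\<^bsub>M\<^esub> y = y" if "y \<in> carrier Y" for y
    using B.act_one[OF that] by (simp add: b_def)
  have b_act: "b n (b m y) = b (n \<otimes>\<^bsub>M\<^esub> m) y"
    if "m \<in> carrier M" "n \<in> carrier M" "y \<in> carrier Y" for m n y
    using B.act_mult[OF that(1,2), of y] B.global that b_closed[OF that(1,3)] by (simp add: b_def)
  define W where "W = {w. w \<noteq> [] \<and> set w \<subseteq> carrier M \<times> carrier X}"
  define g where "g = (\<lambda>(m, x). b m (\<iota> x))"
  define ev where "ev = word_eval (sg_mult Y) g"
  have ev1: "ev [p] = g p" and ev2: "w \<noteq> [] \<Longrightarrow> ev (p # w) = g p \<cdot>\<^bsub>Y\<^esub> ev w" for p w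
    by (auto simp: ev_def neq_Nil_conv)
  have g_closed: "g p \<in> carrier Y" if "p \<in> carrier M \<times> carrier X" for p
    using that by (auto simp: g_def intro!: b_closed iota)
  have ev_closed: "ev w \<in> carrier Y" if "w \<in> W" for w
    using that
  proof (induction w)
    case (Cons p w)
    then show ?case
      by (cases "w = []") (auto simp: W_def ev1 ev2 intro!: g_closed B.mult_closed)
  qed (simp add: W_def)
  have ev_append: "ev (v @ w) = ev v \<cdot>\<^bsub>Y\<^esub> ev w" if "v \<in> W" "w \<in> W" for v w
    using that(1)
  proof (induction v)
    case (Cons p v)
    have w: "w \<noteq> []" using that(2) by (simp add: W_def)
    show ?case
    proof (cases "v = []")
      case True
      then show ?thesis using w by (simp add: ev1 ev2)
    next
      case False
      then have v: "v \<in> W" and p: "p \<in> carrier M \<times> carrier X"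
        using Cons.prems by (auto simp: W_def)
      show ?thesis
        using Cons.IH[OF v] False w B.mult_assoc[OF g_closed[OF p] ev_closed[OF v] ev_closed[OF that(2)]]
        by (simp add: ev2)
    qed
  qed (simp add: W_def)
  define sh where "sh n = map (\<lambda>(m, x). (n \<otimes>\<^bsub>M\<^esub> m, x :: 'a))" for n
  have sh_W: "sh n w \<in> W" if "n \<in> carrier M" "w \<in> W" for n w
    using that by (auto simp: W_def sh_def)
  have g_sh: "g (n \<otimes>\<^bsub>M\<^esub> m, x) = b n (g (m, x))"
    if "n \<in> carrier M" "m \<in> carrier M" "x \<in> carrier X" for n m x
    using that by (simp add: g_def b_act iota)
  have ev_sh: "ev (sh n w) = b n (ev w)" if "n \<in> carrier M" "w \<in> W" for n w
    using that(2)
  proof (induction w)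
    case (Cons p w)
    obtain m x where p: "p = (m, x)" "m \<in> carrier M" "x \<in> carrier X"
      using Cons.prems by (auto simp: W_def)
    show ?case
    proof (cases "w = []")
      case True
      then show ?thesis using p that(1) g_sh by (simp add: ev1 sh_def)
    next
      case False
      then have w: "w \<in> W" using Cons.prems by (auto simp: W_def)
      have "ev (sh n (p # w)) = g (n \<otimes>\<^bsub>M\<^esub> m, x) \<cdot>\<^bsub>Y\<^esub> ev (sh n w)"
        using False p by (simp add: sh_def ev2)
      also have "\<dots> = b n (g p) \<cdot>\<^bsub>Y\<^esub> b n (ev w)"
        using Cons.IH[OF w] p that(1) g_sh by simp
      also have "\<dots> = b n (ev (p # w))"
        using b_mult[OF that(1) g_closed[of p] ev_closed[OF w]] p False by (simp add: ev2)
      finally show ?thesis .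
    qed
  qed (simp add: W_def)
  define S where "S = ev ` W"
  have S_sub: "y \<in> carrier Y" if "y \<in> S" for y
    using that ev_closed by (auto simp: S_def)
  have S_mult: "y \<cdot>\<^bsub>Y\<^esub> z \<in> S" if yz: "y \<in> S" "z \<in> S" for y z
  proof -
    obtain v w where vw: "v \<in> W" "w \<in> W" "y = ev v" "z = ev w"
      using yz by (auto simp: S_def)
    moreover have "v @ w \<in> W" using vw by (auto simp: W_def)
    ultimately show ?thesis using ev_append by (auto simp: S_def intro!: image_eqI[of _ _ "v @ w"])
  qed
  have S_b: "b m y \<in> S" if m: "m \<in> carrier M" and y: "y \<in> S" for m y
  proof -
    obtain w where w: "w \<in> W" "y = ev w" using y by (auto simp: S_def)
    then show ?thesis
      using ev_sh[OF m w(1)] sh_W[OF m w(1)] by (auto simp: S_def intro!: image_eqI[of _ _ "sh m w"])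
  qed
  have S_iota: "\<iota> x \<in> S" if "x \<in> carrier X" for x
  proof -
    have "ev [(\<one>\<^bsub>M\<^esub>, x)] = \<iota> x" using that by (simp add: ev1 g_def b_one iota)
    moreover have "[(\<one>\<^bsub>M\<^esub>, x)] \<in> W" using that by (simp add: W_def)
    ultimately show ?thesis unfolding S_def by (metis imageI)
  qed
  define P where "P y = {w \<in> W. ev w = y}" for y
  have inj: "inj_on P S"
    by (rule inj_onI) (auto simp: P_def S_def)
  define Q where "Q = inv_into S P"
  have QP: "Q (P y) = y" if "y \<in> S" for y
    unfolding Q_def using inj that by (rule inv_into_f_f)
  define Y' :: "('m \<times> 'a) list set semigrp" where
    "Y' = \<lparr>carrier = P ` S, sg_mult = (\<lambda>p q. P (Q p \<cdot>\<^bsub>Y\<^esub> Q q))\<rparr>"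
  define \<beta>' where "\<beta>' m p = (if p \<in> P ` S then Some (P (b m (Q p))) else None)" for m p
  have carr: "carrier Y' = P ` S" by (simp add: Y'_def)
  have mult': "P y \<cdot>\<^bsub>Y'\<^esub> P z = P (y \<cdot>\<^bsub>Y\<^esub> z)" if "y \<in> S" "z \<in> S" for y z
    using that by (simp add: Y'_def QP)
  have act': "\<beta>' m (P y) = Some (P (b m y))" if "y \<in> S" for m y
    using that by (simp add: \<beta>'_def QP)
  have dom': "dom (\<beta>' m) = P ` S" for m
    by (auto simp: \<beta>'_def dom_def)
  have "semigrp_global_action M Y' \<beta>'"
  proof (unfold_locales, goal_cases)
    case (1 x y)
    then show ?case by (auto simp: carr mult' S_mult)
  next
    case (2 x y z)
    then show ?case by (auto simp: carr mult' S_mult B.mult_assoc S_sub)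
  next
    case (4 m)
    then show ?case by (auto simp: carr ran_def \<beta>'_def QP S_b)
  next
    case (6 x)
    then show ?case by (auto simp: carr act' b_one S_sub)
  next
    case (7 m n)
    then show ?case by (auto simp: dom' act' S_b)
  next
    case (8 m n x)
    then show ?case by (auto simp: dom' act' S_b b_act S_sub)
  next
    case (9 m)
    then show ?case by (auto simp: subsemigrp_def carr dom' mult' S_mult)
  next
    case (10 m)
    have "P y \<cdot>\<^bsub>Y'\<lparr>carrier := P ` S\<rparr>\<^esub> P z = P (y \<cdot>\<^bsub>Y\<^esub> z)" if "y \<in> S" "z \<in> S" for y z
      using mult'[OF that] by simp
    with 10 show ?case by (auto simp: semigrp_hom_def carr dom' mult' act' S_mult S_b b_mult S_sub)
  qed (auto simp: carr dom')
  moreover have "action_morphism M X \<alpha> Y' \<beta>' (P \<circ> \<iota>)"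
  proof -
    have "\<beta>' m (P (\<iota> x)) = Some (P (\<iota> (the (\<alpha> m x))))"
      if "m \<in> carrier M" "x \<in> dom (\<alpha> m)" for m x
    proof -
      have "x \<in> carrier X" using A.dom_subset that by blast
      then show ?thesis using iota_act[OF that] by (simp add: act' S_iota b_def)
    qed
    then show ?thesis
      by (auto simp: action_morphism_def semigrp_hom_def carr S_iota mult' iota_mult)
  qed
  moreover have "x \<in> dom (\<alpha> m) \<and> \<alpha> m x = Some y"
    if xy: "x \<in> carrier X" "y \<in> carrier X" and m: "m \<in> carrier M"
      and eq: "\<beta>' m (P (\<iota> x)) = Some (P (\<iota> y))" for x y m
  proof -
    have "P (b m (\<iota> x)) = P (\<iota> y)" using eq xy by (simp add: act' S_iota)
    then have "b m (\<iota> x) = \<iota> y"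
      using inj xy m by (simp add: inj_on_eq_iff S_b S_iota)
    then show ?thesis using refl[OF xy m] beta[OF m iota[OF xy(1)]] by simp
  qed
  ultimately have "globalization M X \<alpha> Y' \<beta>' (P \<circ> \<iota>)"
    by (simp add: globalization_def)
  then show ?thesis unfolding globalizable_def by blast
qed

end

theory Submission
  imports Defs
begin

text \<open>
  The identity \<open>f\<close> of the ideal \<open>im \<alpha>\<^sub>0\<close> is a central idempotent of \<open>X\<close>, and since \<open>\<alpha>\<^sub>0\<close> is a
  retraction onto \<open>im \<alpha>\<^sub>0\<close>, one has \<open>\<alpha>\<^sub>0 x = \<alpha>\<^sub>0 x \<cdot> f = \<alpha>\<^sub>0 (x \<cdot> f) = x \<cdot> f\<close> on \<open>D = dom \<alpha>\<^sub>0\<close>. On the semigroup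
  \<open>X \<times> {1, 0}\<close> the map \<open>(x, i) \<mapsto> (x, 0)\<close> is an idempotent endomorphism; it descends to the quotient by
  the congruence generated by \<open>(x, 0) \<sim> (x \<cdot> f, 1)\<close> for \<open>x \<in> D\<close>, where no two elements \<open>(x, 1)\<close> are
  identified and \<open>(x, 0)\<close> with \<open>x \<notin> D\<close> is identified with no other element.
\<close>

locale ideal_gluing = semigrp +
  fixes D and f
  assumes ideal: "semigrp_ideal D X"
    and f_in: "f \<in> D"
    and f_idem: "f \<cdot> f = f"
    and f_central: "x \<in> carrier X \<Longrightarrow> f \<cdot> x = x \<cdot> f"
begin

lemma D_sub: "x \<in> D \<Longrightarrow> x \<in> carrier X"
  and D_left: "x \<in> carrier X \<Longrightarrow> d \<in> D \<Longrightarrow> x \<cdot> d \<in> D"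
  and D_right: "x \<in> carrier X \<Longrightarrow> d \<in> D \<Longrightarrow> d \<cdot> x \<in> D"
  using ideal by (auto simp: semigrp_ideal_def)

lemma f_carrier: "f \<in> carrier X"
  using f_in by (rule D_sub)

text \<open>\<open>True\<close> encodes 1 and \<open>False\<close> encodes 0. This picks one
  representative of each class of the congruence, marked \<open>True\<close> whenever
  possible.\<close>

definition norm_form :: "'a \<times> bool \<Rightarrow> 'a \<times> bool" where
  "norm_form p = (if \<not> snd p \<and> fst p \<in> D then (fst p \<cdot> f, True) else p)"

definition prod01 :: "'a \<times> bool \<Rightarrow> 'a \<times> bool \<Rightarrow> 'a \<times> bool" where
  "prod01 p q = (fst p \<cdot> fst q, snd p \<and> snd q)"

definition proj0 :: "'a \<times> bool \<Rightarrow> 'a \<times> bool" where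
  "proj0 p = (fst p, False)"

text \<open>The quotient is realized on the normal forms of its elements.\<close>

definition glued :: "('a \<times> bool) semigrp" where
  "glued = \<lparr>carrier = norm_form ` (carrier X \<times> UNIV), sg_mult = (\<lambda>p q. norm_form (prod01 p q))\<rparr>"

definition glued_act :: "nat \<Rightarrow> 'a \<times> bool \<rightharpoonup> 'a \<times> bool" where
  "glued_act m p = (if p \<notin> carrier glued then None
     else if m = 0 then Some (norm_form (proj0 p)) else Some p)"

lemma norm_form_True [simp]: "norm_form (x, True) = (x, True)"
  by (simp add: norm_form_def)

lemma xff: "x \<in> carrier X \<Longrightarrow> (x \<cdot> f) \<cdot> f = x \<cdot> f"
  by (simp add: mult_assoc f_carrier f_idem)

lemma xfy: "x \<in> carrier X \<Longrightarrow> y \<in> carrier X \<Longrightarrow> (x \<cdot> f) \<cdot> y = (x \<cdot> y) \<cdot> f"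
  using f_central[of y] by (simp add: mult_assoc f_carrier)

lemma xyf: "x \<in> carrier X \<Longrightarrow> y \<in> carrier X \<Longrightarrow> x \<cdot> (y \<cdot> f) = (x \<cdot> y) \<cdot> f"
  by (simp add: mult_assoc f_carrier)

lemma norm_form_in: "p \<in> carrier X \<times> UNIV \<Longrightarrow> norm_form p \<in> carrier X \<times> UNIV"
  by (auto simp: norm_form_def mult_closed f_carrier)

lemma prod01_in: "p \<in> carrier X \<times> UNIV \<Longrightarrow> q \<in> carrier X \<times> UNIV \<Longrightarrow> prod01 p q \<in> carrier X \<times> UNIV"
  by (auto simp: prod01_def mult_closed)

lemma prod01_assoc:
  assumes "p \<in> carrier X \<times> UNIV" "q \<in> carrier X \<times> UNIV" "r \<in> carrier X \<times> UNIV"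
  shows "prod01 (prod01 p q) r = prod01 p (prod01 q r)"
  using assms by (auto simp: prod01_def mult_assoc)

text \<open>Only \<open>p = (x, False)\<close> with \<open>x\<close> in \<open>D\<close> needs an
  argument. Then \<open>x \<cdot> y\<close> is in \<open>D\<close>; moving the central
  \<open>f\<close> to the right, and absorbing a second \<open>f\<close> if \<open>q\<close> is
  marked \<open>False\<close>, turns both sides into
  \<open>((x \<cdot> y) \<cdot> f, True)\<close>.\<close>

lemma norm_form_prod01_left:
  assumes "p \<in> carrier X \<times> UNIV" "q \<in> carrier X \<times> UNIV"
  shows "norm_form (prod01 (norm_form p) q) = norm_form (prod01 p q)"
proof -
  obtain x i y j where "p = (x, i)" "q = (y, j)" "x \<in> carrier X" "y \<in> carrier X"
    using assms by auto
  with xfy[of x y] xff[of "x \<cdot> y"] show ?thesis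
    by (simp add: norm_form_def prod01_def mult_closed D_right D_left f_in)
qed

lemma norm_form_prod01_right:
  assumes "p \<in> carrier X \<times> UNIV" "q \<in> carrier X \<times> UNIV"
  shows "norm_form (prod01 p (norm_form q)) = norm_form (prod01 p q)"
proof -
  obtain x i y j where "p = (x, i)" "q = (y, j)" "x \<in> carrier X" "y \<in> carrier X"
    using assms by auto
  with xyf[of x y] xff[of "x \<cdot> y"] show ?thesis
    by (simp add: norm_form_def prod01_def mult_closed D_right D_left f_in)
qed

text \<open>For \<open>x\<close> in \<open>D\<close>, projecting \<open>(x \<cdot> f, True)\<close>
  gives \<open>(x \<cdot> f, False)\<close>, which reduces back to
  \<open>(x \<cdot> f, True)\<close> because \<open>f\<close> is idempotent.\<close>

lemma norm_form_proj0:
  "p \<in> carrier X \<times> UNIV \<Longrightarrow> norm_form (proj0 (norm_form p)) = norm_form (proj0 p)"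
  by (auto simp: norm_form_def proj0_def xff D_left f_in)

lemma proj0_in: "p \<in> carrier X \<times> UNIV \<Longrightarrow> proj0 p \<in> carrier X \<times> UNIV"
  by (auto simp: proj0_def)

lemma proj0_prod01: "proj0 (prod01 p q) = prod01 (proj0 p) (proj0 q)"
  by (simp add: proj0_def prod01_def)

lemma carrier_glued: "carrier glued = norm_form ` (carrier X \<times> UNIV)"
  by (simp add: glued_def)

lemma norm_form_glued: "p \<in> carrier X \<times> UNIV \<Longrightarrow> norm_form p \<in> carrier glued"
  by (simp add: carrier_glued)

text \<open>Hence \<open>norm_form\<close> is a homomorphism from the product of \<open>X\<close>
  and \<open>{1, 0}\<close> onto \<open>glued\<close>, and laws can be checked on arbitrary
  representatives.\<close>

lemma glued_mult:
  assumes "p \<in> carrier X \<times> UNIV" "q \<in> carrier X \<times> UNIV"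
  shows "norm_form p \<cdot>\<^bsub>glued\<^esub> norm_form q = norm_form (prod01 p q)"
  using assms
  by (simp add: glued_def norm_form_prod01_left norm_form_prod01_right norm_form_in)

lemma glued_act_norm_form:
  assumes "p \<in> carrier X \<times> UNIV"
  shows "glued_act m (norm_form p) = Some (norm_form (if m = 0 then proj0 p else p))"
  using assms by (simp add: glued_act_def norm_form_glued norm_form_proj0)

lemma dom_glued_act: "dom (glued_act m) = carrier glued"
  by (auto simp: glued_act_def dom_def)

lemma gluedE:
  assumes "p \<in> carrier glued"
  obtains p' where "p' \<in> carrier X \<times> UNIV" "p = norm_form p'"
  using assms by (auto simp only: carrier_glued)

lemma proj0_idem [simp]: "proj0 (proj0 p) = proj0 p"
  by (simp add: proj0_def)

lemma glued_global_action: "semigrp_global_action monoid01 glued glued_act"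
proof -
  interpret M01: monoid monoid01
    by (rule monoid_monoid01)
  note in_simps = glued_mult glued_act_norm_form prod01_in proj0_in norm_form_glued
  show ?thesis
  \<comment> \<open>The goals left to the end are 3, 5 and 11, which only concern domains; the
    others follow the order of the locale axioms.\<close>
  proof (unfold_locales, goal_cases)
    case (1 p q)
    then show ?case
      by (elim gluedE) (simp add: in_simps)
  next
    case (2 p q r)
    then show ?case
      by (elim gluedE) (simp add: in_simps prod01_assoc)
  next
    case (4 m)
    show ?case
    proof
      fix q assume "q \<in> ran (glued_act m)"
      then obtain p where p: "glued_act m p = Some q" by (auto simp: ran_def)
      then have "p \<in> carrier glued" by (metis dom_glued_act domI)
      with p show "q \<in> carrier glued"
        by (elim gluedE) (auto simp: in_simps split: if_splits)
    qed
  next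
    case (6 p)
    then show ?case by (simp add: glued_act_def monoid01_def)
  next
    case (7 m n)
    have "the (glued_act m p) \<in> carrier glued" if "p \<in> carrier glued" for p
      using that by (elim gluedE) (simp add: in_simps)
    then show ?case by (auto simp: dom_glued_act)
  next
    case (8 m n p)
    then have "p \<in> carrier glued" by (simp add: dom_glued_act)
    \<comment> \<open>A product in \<open>monoid01\<close> is 0 iff a factor is, which matches the
      idempotence of \<open>proj0\<close>.\<close>
    with 8(1,2) show ?case
      by (elim gluedE) (auto simp: in_simps monoid01_def)
  next
    case (9 m)
    have "p \<cdot>\<^bsub>glued\<^esub> q \<in> carrier glued" if "p \<in> carrier glued" "q \<in> carrier glued" for p q
      using that by (elim gluedE) (simp add: in_simps)
    then show ?case by (auto simp: subsemigrp_def dom_glued_act)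
  next
    case (10 m)
    have "the (glued_act m p) \<in> carrier glued" if "p \<in> carrier glued" for p
      using that by (elim gluedE) (simp add: in_simps)
    moreover have "the (glued_act m (p \<cdot>\<^bsub>glued\<^esub> q))
        = the (glued_act m p) \<cdot>\<^bsub>glued\<^esub> the (glued_act m q)"
      if "p \<in> carrier glued" "q \<in> carrier glued" for p q
      using that by (elim gluedE) (simp add: in_simps proj0_prod01)
    ultimately show ?case
      by (auto simp: semigrp_hom_def dom_glued_act)
  qed (simp_all add: dom_glued_act)
qed

lemma embed_glued: "x \<in> carrier X \<Longrightarrow> (x, True) \<in> carrier glued"
  using norm_form_glued[of "(x, True)"] by simp

lemma glued_act_embed:
  "x \<in> carrier X \<Longrightarrow> glued_act m (x, True) =
     Some (if m \<noteq> 0 then (x, True) else if x \<in> D then (x \<cdot> f, True) else (x, False))"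
  by (simp add: glued_act_def embed_glued proj0_def norm_form_def)

text \<open>The action of 0 sends \<open>(x, True)\<close> back into the copy of \<open>X\<close>
  only for \<open>x\<close> in \<open>D\<close>, since otherwise the result is marked
  \<open>False\<close>. This yields the condition that separates a globalization from a mere
  morphism.\<close>

lemma globalization_glued:
  assumes dom0: "dom (\<alpha> 0) = D"
    and act0: "\<And>x. x \<in> D \<Longrightarrow> \<alpha> 0 x = Some (x \<cdot> f)"
    and dom1: "dom (\<alpha> 1) = carrier X"
    and act1: "\<And>x. x \<in> carrier X \<Longrightarrow> \<alpha> 1 x = Some x"
  shows "globalization monoid01 X \<alpha> glued glued_act (\<lambda>x. (x, True))"
proof -
  have "(x, True) \<cdot>\<^bsub>glued\<^esub> (y, True) = (x \<cdot> y, True)" for x y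
    by (simp add: glued_def prod01_def)
  then have "action_morphism monoid01 X \<alpha> glued glued_act (\<lambda>x. (x, True))"
    using dom0 dom1 act0 act1 D_sub
    by (auto simp: action_morphism_def semigrp_hom_def embed_glued monoid01_def glued_act_embed)
  moreover have "x \<in> dom (\<alpha> m) \<and> \<alpha> m x = Some y"
    if "x \<in> carrier X" "m \<in> carrier monoid01" "glued_act m (x, True) = Some (y, True)" for x y m
    using that act0 act1 dom0
    by (auto simp: glued_act_embed monoid01_def split: if_splits)
  ultimately show ?thesis
    using glued_global_action by (simp add: globalization_def)
qed

end

text \<open>Both products lie in \<open>I\<close>, so each equals
  \<open>u \<cdot> x \<cdot> u\<close>.\<close>

lemma (in semigrp) ideal_unit_central:
  assumes "semigrp_ideal I X" "u \<in> I" "\<And>i. i \<in> I \<Longrightarrow> u \<cdot> i = i \<and> i \<cdot> u = i" "x \<in> carrier X"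
  shows "u \<cdot> x = x \<cdot> u"
proof -
  have u: "u \<in> carrier X" and I: "u \<cdot> x \<in> I" "x \<cdot> u \<in> I"
    using assms by (auto simp: semigrp_ideal_def)
  have "u \<cdot> x = (u \<cdot> x) \<cdot> u" using assms(3)[OF I(1)] by simp
  also have "\<dots> = u \<cdot> (x \<cdot> u)" using u assms(4) by (simp add: mult_assoc)
  also have "\<dots> = x \<cdot> u" using assms(3)[OF I(2)] by simp
  finally show ?thesis .
qed

theorem corollary4p11:
  fixes X :: "'a semigrp" and \<alpha> :: "nat \<Rightarrow> 'a \<rightharpoonup> 'a"
  assumes "semigrp_strong_partial_action monoid01 X \<alpha>"
    and "\<And>m. m \<in> carrier monoid01 \<Longrightarrow> semigrp_ideal (dom (\<alpha> m)) X"
    and "\<And>m. m \<in> carrier monoid01 \<Longrightarrow> semigrp_ideal (ran (\<alpha> m)) X"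
    and "unital_ideal (dom (\<alpha> 0)) X"
    and "unital_ideal (ran (\<alpha> 0)) X"
  shows "globalizable monoid01 X \<alpha>"
proof -
  interpret A: semigrp_strong_partial_action monoid01 X \<alpha> by fact
  have M [simp]: "0 \<in> carrier monoid01" "Suc 0 \<in> carrier monoid01" "\<one>\<^bsub>monoid01\<^esub> = 1"
    "0 \<otimes>\<^bsub>monoid01\<^esub> 0 = 0"
    by (simp_all add: monoid01_def)
  define D where "D = dom (\<alpha> 0)"
  define a where "a x = the (\<alpha> 0 x)" for x
  have act: "\<alpha> 0 x = Some (a x)" if "x \<in> D" for x
    using that by (auto simp: D_def a_def)
  have ideal: "semigrp_ideal D X"
    unfolding D_def by (rule assms(2)) simp
  have ran: "ran (\<alpha> 0) = a ` D"
    by (force simp: ran_def D_def a_def)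
  \<comment> \<open>As \<open>0 \<otimes> 0 = 0\<close>, the preimage of \<open>D\<close> under
    \<open>a\<close> is all of \<open>D\<close>.\<close>
  have a_D: "a x \<in> D" if "x \<in> D" for x
    using A.preimage_dom[of 0 0] that by (auto simp: D_def a_def)
  have a_idem: "a (a x) = a x" if "x \<in> D" for x
    using A.act_mult[of 0 0 x] that a_D[OF that] by (simp add: D_def a_def)
  have a_mult: "a (x \<cdot>\<^bsub>X\<^esub> y) = a x \<cdot>\<^bsub>X\<^esub> a y" if "x \<in> D" "y \<in> D" for x y
    using A.act_hom[of 0] that by (simp add: semigrp_hom_def D_def a_def)
  obtain f where f: "f \<in> a ` D" and unit: "\<And>i. i \<in> a ` D \<Longrightarrow> f \<cdot>\<^bsub>X\<^esub> i = i \<and> i \<cdot>\<^bsub>X\<^esub> f = i"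
    and ideal_ran: "semigrp_ideal (a ` D) X"
    using assms(5) unfolding unital_ideal_def ran by blast
  have f_D: "f \<in> D" and a_f: "a f = f" using f a_D a_idem by auto
  interpret ideal_gluing X D f
    using ideal f_D unit f A.ideal_unit_central[OF ideal_ran f unit]
    by unfold_locales auto
  have a_eq: "a x = x \<cdot>\<^bsub>X\<^esub> f" if x: "x \<in> D" for x
  proof -
    \<comment> \<open>The image is an ideal containing \<open>f\<close>, and \<open>a\<close> fixes
      it pointwise by \<open>a_idem\<close>.\<close>
    have "x \<cdot>\<^bsub>X\<^esub> f \<in> a ` D"
      using ideal_ran f D_sub[OF x] unfolding semigrp_ideal_def by blast
    then have "x \<cdot>\<^bsub>X\<^esub> f = a (x \<cdot>\<^bsub>X\<^esub> f)" using a_idem by auto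
    also have "\<dots> = a x \<cdot>\<^bsub>X\<^esub> f" using x f_D by (simp add: a_mult a_f)
    also have "\<dots> = a x" using unit x by blast
    finally show ?thesis by simp
  qed
  have "globalization monoid01 X \<alpha> glued glued_act (\<lambda>x. (x, True))"
    using act a_eq A.dom_one A.act_one by (intro globalization_glued) (simp_all add: D_def)
  \<comment> \<open>The elements of \<open>glued\<close> are pairs, so the globalization has to be
    transferred to the type fixed in \<open>globalizable\<close>.\<close>
  then show ?thesis by (rule globalizableI[OF assms(1)])
qed

end
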